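(* A four-body convex central configuration with positive masses in which one diagonal bisects the other (i.e. one diagonal passes through the midpoint of the other) must be a kite.
   Context: For bodies at pairwise distinct positions $q_1,\dots,q_4\in\mathbb{R}^2$ with masses $m_1,\dots,m_4>0$, put $M=\sum_i m_i$, $r_{ij}=\|q_i-q_j\|$, $U(q)=\sum_{i<j} m_im_j/r_{ij}$ and $I(q)=\frac1M\sum_{i<j}m_im_jr_{ij}^2$. The configuration $q=(q_1,\dots,q_4)\in\mathbb{R}^8$ is a (planar) central configuration if it is a critical point of $U$ subject to the constraint $I=I_0$, for some constant $I_0>0$. It is convex if no body lies in the convex hull of the other three, so that the bodies are the vertices of a strictly convex quadrilateral. A kite is a quadrilateral symmetric about a line, with two of the bodies lying on the axis of symmetry and the other two positioned equidistant from it (as mirror images of each other). *)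

theory Defs
  imports "HOL-Analysis.Analysis"
begin

text \<open>The bodies are indexed by the four-element type \<open>4\<close> of the numeral type library, whose elements are
  \<open>0 < 1 < 2 < 3\<close>. A configuration is a point of \<open>(real^2)^4\<close>, which carries the Euclidean
  structure of \<open>R^8\<close>.\<close>

type_synonym masses = "real^4"
type_synonym config = "(real^2)^4"

definition total_mass :: "masses \<Rightarrow> real" where
  "total_mass m = (\<Sum>i\<in>UNIV. m $ i)"

definition body_pairs :: "(4 \<times> 4) set" where
  "body_pairs = {(i, j). i < j}"

definition potential :: "masses \<Rightarrow> config \<Rightarrow> real" where
  "potential m q = (\<Sum>(i, j)\<in>body_pairs. m $ i * m $ j / dist (q $ i) (q $ j))"

definition inertia :: "masses \<Rightarrow> config \<Rightarrow> real" where
  "inertia m q = (1 / total_mass m) * (\<Sum>(i, j)\<in>body_pairs. m $ i * m $ j * (dist (q $ i) (q $ j))\<^sup>2)"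

text \<open>A critical point of \<open>F\<close> restricted to the level set \<open>G = c\<close>: the derivative of \<open>F\<close> vanishes
  along every curve in the level set that passes through the point and is differentiable there.
  At a point where \<open>F\<close> and \<open>G\<close> are continuously differentiable and the derivative of \<open>G\<close> is nonzero,
  the velocities of such curves form the tangent space of the level set.\<close>

definition constrained_critical_point ::
  "('a::real_normed_vector \<Rightarrow> real) \<Rightarrow> ('a \<Rightarrow> real) \<Rightarrow> real \<Rightarrow> 'a \<Rightarrow> bool" where
  "constrained_critical_point F G c p \<longleftrightarrow>
     G p = c \<and>
     (\<forall>\<gamma>. \<gamma> 0 = p \<and> (\<forall>t::real. G (\<gamma> t) = c) \<and> \<gamma> differentiable (at 0)
        \<longrightarrow> ((\<lambda>t. F (\<gamma> t)) has_real_derivative 0) (at 0))"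

text \<open>Pairwise distinctness of the positions keeps the potential away from its singularities,
  where division by zero would give it a meaningless value.\<close>

definition central_configuration :: "masses \<Rightarrow> config \<Rightarrow> bool" where
  "central_configuration m q \<longleftrightarrow>
     inj (\<lambda>i. q $ i) \<and>
     (\<exists>I0>0. constrained_critical_point (potential m) (inertia m) I0 q)"

definition convex_configuration :: "config \<Rightarrow> bool" where
  "convex_configuration q \<longleftrightarrow> (\<forall>i. q $ i \<notin> convex hull {q $ j | j. j \<noteq> i})"

text \<open>For a convex configuration: the segment joining the vertices \<open>i\<close> and \<open>j\<close> is not a side of the
  quadrilateral.\<close>

definition is_diagonal :: "config \<Rightarrow> 4 \<Rightarrow> 4 \<Rightarrow> bool" where
  "is_diagonal q i j \<longleftrightarrow>
     i \<noteq> j \<and> \<not> closed_segment (q $ i) (q $ j) edge_of convex hull (range (\<lambda>k. q $ k))"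

definition some_diagonal_bisects_other :: "config \<Rightarrow> bool" where
  "some_diagonal_bisects_other q \<longleftrightarrow>
     (\<exists>i j k l. is_diagonal q i j \<and> is_diagonal q k l \<and> {i, j} \<noteq> {k, l} \<and>
        midpoint (q $ k) (q $ l) \<in> closed_segment (q $ i) (q $ j))"

definition is_line :: "(real^2) set \<Rightarrow> bool" where
  "is_line L \<longleftrightarrow> affine L \<and> aff_dim L = 1"

definition mirror_images :: "(real^2) set \<Rightarrow> real^2 \<Rightarrow> real^2 \<Rightarrow> bool" where
  "mirror_images L x y \<longleftrightarrow>
     midpoint x y \<in> L \<and> (\<forall>u\<in>L. \<forall>v\<in>L. (u - v) \<bullet> (x - y) = 0)"

text \<open>The shape alone matters, not the masses. When the positions are pairwise distinct, the two
  bodies that are mirror images of each other necessarily lie off the axis.\<close>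

definition kite :: "config \<Rightarrow> bool" where
  "kite q \<longleftrightarrow>
     (\<exists>L a b c d. is_line L \<and> distinct [a, b, c, d] \<and>
        q $ a \<in> L \<and> q $ b \<in> L \<and> mirror_images L (q $ c) (q $ d))"

end

(* U is homogeneous of degree -1 and I of degree 2, so every line t |-> q + t v can be rescaled into the
   level set of I. Differentiating U along the rescaled line yields the equations of central
   configurations, sum_j m_j S_ij (q_i - q_j) = 0 with S_ij = 1 / r_ij^3 - kappa.

   Let the diagonal ij pass through the midpoint of kl. Projecting the equations of i and j orthogonally
   to ij gives m_k S_ik = m_l S_il and m_k S_jk = m_l S_jl; projecting that of k orthogonally to kl shows
   that S_ik and S_jk are positively proportional. If ij is not orthogonal to kl, then r_ik - r_il and
   r_jk - r_jl have opposite signs, so the first two equations order m_k and m_l in opposite ways. *)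
theory Submission
  imports Defs
begin

section \<open>The equations of central configurations\<close>

text \<open>Passes from the unordered pairs in \<open>potential\<close> and \<open>inertia\<close>
  to a double sum over all bodies, in which the equation of a single body appears as one
  row.\<close>

lemma sum_body_pairs_symmetric:
  fixes f :: "4 \<Rightarrow> 4 \<Rightarrow> real"
  assumes sym: "\<And>i j. f i j = f j i" and diag: "\<And>i. f i i = 0"
  shows "(\<Sum>i\<in>UNIV. \<Sum>j\<in>UNIV. f i j) = 2 * (\<Sum>(i, j)\<in>body_pairs. f i j)"
proof -
  let ?D = "range (\<lambda>i::4. (i, i))"
  have swap: "prod.swap ` body_pairs = {(i, j). j < i}"
    by (auto simp: body_pairs_def image_iff)
  have UNIV_eq: "UNIV = (body_pairs \<union> prod.swap ` body_pairs) \<union> ?D"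
    unfolding swap by (auto simp: body_pairs_def)
  have "(\<Sum>i\<in>UNIV. \<Sum>j\<in>UNIV. f i j) = (\<Sum>(i, j)\<in>UNIV. f i j)"
    by (simp add: sum.cartesian_product)
  also have "\<dots> = (\<Sum>(i, j)\<in>body_pairs \<union> prod.swap ` body_pairs. f i j) + (\<Sum>(i, j)\<in>?D. f i j)"
    by (subst UNIV_eq, rule sum.union_disjoint) (auto simp: swap body_pairs_def)
  also have "(\<Sum>(i, j)\<in>?D. f i j) = 0"
    by (rule sum.neutral) (auto simp: diag)
  also have "(\<Sum>(i, j)\<in>body_pairs \<union> prod.swap ` body_pairs. f i j) =
      (\<Sum>(i, j)\<in>body_pairs. f i j) + (\<Sum>(i, j)\<in>prod.swap ` body_pairs. f i j)"
    by (rule sum.union_disjoint) (auto simp: body_pairs_def)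
  also have "(\<Sum>(i, j)\<in>prod.swap ` body_pairs. f i j) = (\<Sum>(i, j)\<in>body_pairs. f i j)"
    by (subst sum.reindex) (auto simp: inj_on_def sym intro!: sum.cong)
  finally show ?thesis by simp
qed

section \<open>Derivatives of the potential and the inertia along straight lines\<close>

lemma norm_line_has_real_derivative:
  fixes x y :: "'a::real_inner"
  assumes "x \<noteq> 0"
  shows "((\<lambda>t. norm (x + t *\<^sub>R y)) has_real_derivative (x \<bullet> y) / norm x) (at 0)"
proof -
  have "x \<bullet> x > 0"
    using assms by simp
  \<comment> \<open>The norm along the line is the root of a quadratic polynomial in
    \<open>t\<close>; positivity of \<open>x \<bullet> x\<close> makes the root differentiable at
    0.\<close>
  then have "((\<lambda>t. sqrt (x \<bullet> x + 2 * t * (x \<bullet> y) + t\<^sup>2 * (y \<bullet> y))) has_real_derivative (x \<bullet> y) / norm x) (at 0)"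
    by (auto intro!: derivative_eq_intros simp del: inner_gt_zero_iff simp: norm_eq_sqrt_inner field_simps)
  moreover have "norm (x + t *\<^sub>R y) = sqrt (x \<bullet> x + 2 * t * (x \<bullet> y) + t\<^sup>2 * (y \<bullet> y))" for t
    by (simp add: norm_eq_sqrt_inner inner_simps inner_commute power2_eq_square algebra_simps)
  ultimately show ?thesis by simp
qed

lemma dist_line_has_real_derivative:
  fixes q v :: config
  assumes "q $ i \<noteq> q $ j"
  shows "((\<lambda>t. dist ((q + t *\<^sub>R v) $ i) ((q + t *\<^sub>R v) $ j)) has_real_derivative
    ((q $ i - q $ j) \<bullet> (v $ i - v $ j)) / dist (q $ i) (q $ j)) (at 0)"
proof -
  have "(\<lambda>t. dist ((q + t *\<^sub>R v) $ i) ((q + t *\<^sub>R v) $ j)) =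
      (\<lambda>t. norm ((q $ i - q $ j) + t *\<^sub>R (v $ i - v $ j)))"
    by (auto simp: dist_norm algebra_simps)
  then show ?thesis
    using norm_line_has_real_derivative[of "q $ i - q $ j" "v $ i - v $ j"] assms
    by (simp add: dist_norm)
qed

lemma potential_line_has_real_derivative:
  assumes "inj (\<lambda>i. q $ i)"
  shows "((\<lambda>t. potential m (q + t *\<^sub>R v)) has_real_derivative
    - (\<Sum>(i, j)\<in>body_pairs. m $ i * m $ j * ((q $ i - q $ j) \<bullet> (v $ i - v $ j)) / dist (q $ i) (q $ j) ^ 3))
    (at 0)"
  unfolding potential_def sum_negf[symmetric]
proof (rule DERIV_sum, unfold split_paired_all prod.case)
  fix i j :: 4 assume "(i, j) \<in> body_pairs"
  then have "q $ i \<noteq> q $ j"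
    using assms by (auto simp: body_pairs_def inj_def)
  then show "((\<lambda>t. m $ i * m $ j / dist ((q + t *\<^sub>R v) $ i) ((q + t *\<^sub>R v) $ j)) has_real_derivative
      - (m $ i * m $ j * ((q $ i - q $ j) \<bullet> (v $ i - v $ j)) / dist (q $ i) (q $ j) ^ 3)) (at 0)"
    using dist_line_has_real_derivative[of q i j v]
    by (auto intro!: derivative_eq_intros simp: field_simps power3_eq_cube)
qed

lemma inertia_line_has_real_derivative:
  assumes "inj (\<lambda>i. q $ i)"
  shows "((\<lambda>t. inertia m (q + t *\<^sub>R v)) has_real_derivative
    (1 / total_mass m) * (2 * (\<Sum>(i, j)\<in>body_pairs. m $ i * m $ j * ((q $ i - q $ j) \<bullet> (v $ i - v $ j)))))
    (at 0)"
  unfolding inertia_def sum_distrib_left[of 2]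
proof (rule DERIV_cmult, rule DERIV_sum, unfold split_paired_all prod.case)
  fix i j :: 4 assume "(i, j) \<in> body_pairs"
  then have "q $ i \<noteq> q $ j"
    using assms by (auto simp: body_pairs_def inj_def)
  then show "((\<lambda>t. m $ i * m $ j * (dist ((q + t *\<^sub>R v) $ i) ((q + t *\<^sub>R v) $ j))\<^sup>2) has_real_derivative
      2 * (m $ i * m $ j * ((q $ i - q $ j) \<bullet> (v $ i - v $ j)))) (at 0)"
    using dist_line_has_real_derivative[of q i j v]
    by (auto intro!: derivative_eq_intros simp: field_simps)
qed

section \<open>Homogeneity and the explicit multiplier\<close>

lemma dist_scaleR_both:
  fixes x y :: "'a::real_normed_vector"
  shows "dist (c *\<^sub>R x) (c *\<^sub>R y) = \<bar>c\<bar> * dist x y"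
  by (simp add: dist_norm flip: scaleR_diff_right)

lemma potential_scaleR:
  assumes "c > 0"
  shows "potential m (c *\<^sub>R q) = potential m q / c"
  using assms unfolding potential_def
  by (auto simp: sum_divide_distrib dist_scaleR_both field_simps intro!: sum.cong)

lemma inertia_scaleR: "inertia m (c *\<^sub>R q) = c\<^sup>2 * inertia m q"
  unfolding inertia_def
  by (auto simp: sum_distrib_left dist_scaleR_both power_mult_distrib field_simps intro!: sum.cong)

text \<open>On the level set the potential of the rescaled line is U * sqrt (I / I0), evaluated
  along the unscaled line. The product rule gives its derivative at 0, which criticality sends to 0;
  homogeneity thus makes the multiplier explicit.\<close>

lemma critical_point_multiplier:
  assumes "I0 > 0"
    and crit: "constrained_critical_point (potential m) (inertia m) I0 q"
    and U: "((\<lambda>t. potential m (q + t *\<^sub>R v)) has_real_derivative dU) (at 0)"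
    and I: "((\<lambda>t. inertia m (q + t *\<^sub>R v)) has_real_derivative dI) (at 0)"
  shows "dU + potential m q / (2 * I0) * dI = 0"
proof -
  have Iq: "inertia m q = I0"
    using crit by (simp add: constrained_critical_point_def)
  define g where "g t = sqrt (I0 / inertia m (q + t *\<^sub>R v))" for t :: real
  \<comment> \<open>A competing curve must stay in the level set for every real \<open>t\<close>,
    whereas the rescaling is meaningful only where the inertia is positive. The constant value
    \<open>q\<close> fills in elsewhere; near 0 it never occurs.\<close>
  define \<gamma> where "\<gamma> t = (if inertia m (q + t *\<^sub>R v) > 0 then g t *\<^sub>R (q + t *\<^sub>R v) else q)" for t
  have ev: "\<forall>\<^sub>F t in nhds 0. inertia m (q + t *\<^sub>R v) > 0"
  proof -
    have "isCont (\<lambda>t. inertia m (q + t *\<^sub>R v)) 0"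
      using I by (rule DERIV_isCont)
    then have "((\<lambda>t. inertia m (q + t *\<^sub>R v)) \<longlongrightarrow> I0) (at 0)"
      by (simp add: isCont_def Iq)
    then have "\<forall>\<^sub>F t in at 0. inertia m (q + t *\<^sub>R v) > 0"
      using \<open>I0 > 0\<close> by (rule order_tendstoD(1))
    then show ?thesis
      using \<open>I0 > 0\<close> by (simp add: eventually_nhds_conv_at Iq)
  qed
  have "inertia m (\<gamma> t) = I0" for t
    using \<open>I0 > 0\<close> by (auto simp: \<gamma>_def g_def Iq inertia_scaleR)
  moreover have "\<gamma> 0 = q"
    using \<open>I0 > 0\<close> by (simp add: \<gamma>_def g_def Iq)
  moreover have "\<gamma> differentiable (at 0)"
  proof -
    have "(g has_real_derivative - dI / (2 * I0)) (at 0)"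
      unfolding g_def using I \<open>I0 > 0\<close>
      by (auto intro!: derivative_eq_intros simp: Iq field_simps)
    then have "((\<lambda>t. g t *\<^sub>R (q + t *\<^sub>R v)) has_vector_derivative
        (g 0 *\<^sub>R v + (- dI / (2 * I0)) *\<^sub>R (q + 0 *\<^sub>R v))) (at 0)"
      by (intro has_vector_derivative_scaleR) (auto intro!: derivative_eq_intros)
    moreover have eq: "\<forall>\<^sub>F t in nhds 0. t \<in> UNIV \<longrightarrow> \<gamma> t = g t *\<^sub>R (q + t *\<^sub>R v)"
      using ev by eventually_elim (simp add: \<gamma>_def)
    moreover have "\<gamma> 0 = g 0 *\<^sub>R (q + 0 *\<^sub>R v)"
      using eventually_nhds_x_imp_x[OF eq] by simp
    ultimately have "(\<gamma> has_vector_derivative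
        (g 0 *\<^sub>R v + (- dI / (2 * I0)) *\<^sub>R (q + 0 *\<^sub>R v))) (at 0)"
      by (simp only: has_vector_derivative_cong_ev[of UNIV \<gamma> "\<lambda>t. g t *\<^sub>R (q + t *\<^sub>R v)"])
    then show ?thesis
      by (rule differentiableI_vector)
  qed
  ultimately have "((\<lambda>t. potential m (\<gamma> t)) has_real_derivative 0) (at 0)"
    using crit by (auto simp: constrained_critical_point_def)
  \<comment> \<open>Degree -1 turns the factor \<open>g t\<close> into 1 / \<open>g t\<close>, the
    square root of I / I0.\<close>
  moreover have eq: "\<forall>\<^sub>F t in nhds 0.
      potential m (\<gamma> t) = potential m (q + t *\<^sub>R v) * sqrt (inertia m (q + t *\<^sub>R v) / I0)"
    using ev
  proof eventually_elim
    case (elim t)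
    then have "g t > 0"
      using \<open>I0 > 0\<close> by (simp add: g_def)
    then show ?case
      using elim by (simp add: \<gamma>_def potential_scaleR) (simp add: g_def real_sqrt_divide)
  qed
  ultimately have "((\<lambda>t. potential m (q + t *\<^sub>R v) * sqrt (inertia m (q + t *\<^sub>R v) / I0))
      has_real_derivative 0) (at 0)"
    by (simp only: DERIV_cong_ev[OF refl eq refl])
  moreover have "((\<lambda>t. potential m (q + t *\<^sub>R v) * sqrt (inertia m (q + t *\<^sub>R v) / I0))
      has_real_derivative dU + potential m q / (2 * I0) * dI) (at 0)"
    using U I \<open>I0 > 0\<close> by (auto intro!: derivative_eq_intros simp: Iq field_simps)
  ultimately show ?thesis
    by (rule DERIV_unique[symmetric])
qed

text \<open>The multiplier identity is tested on displacements of one body. The vector equation is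
  stated through its projections on arbitrary \<open>e\<close>. The summand for the body itself
  involves a division by zero but is multiplied by a zero difference.\<close>

lemma central_configuration_equations:
  assumes pos: "\<And>i. m $ i > 0" and "central_configuration m q"
  obtains \<kappa> where "\<And>i e. (\<Sum>j\<in>UNIV. m $ j * (1 / dist (q $ i) (q $ j) ^ 3 - \<kappa>) * ((q $ i - q $ j) \<bullet> e)) = 0"
proof -
  obtain I0 where inj: "inj (\<lambda>i. q $ i)" and I0: "I0 > 0"
    and crit: "constrained_critical_point (potential m) (inertia m) I0 q"
    using assms(2) by (auto simp: central_configuration_def)
  \<comment> \<open>The multiplier U / (2 * I0) times the factor 2 / M from the derivative of the
    inertia.\<close>
  define \<kappa> where "\<kappa> = potential m q / (I0 * total_mass m)"
  define c where "c i j = m $ i * m $ j * (1 / dist (q $ i) (q $ j) ^ 3 - \<kappa>)" for i j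
  have c_sym: "c i j = c j i" for i j
    by (simp add: c_def dist_commute)
  have "m $ i * (\<Sum>j\<in>UNIV. m $ j * (1 / dist (q $ i) (q $ j) ^ 3 - \<kappa>) * ((q $ i - q $ j) \<bullet> e)) = 0" for i e
  proof -
    \<comment> \<open>Only body \<open>i\<close> moves, in direction \<open>e\<close>.\<close>
    define v :: config where "v = axis i e"
    \<comment> \<open>Each pair term is split into one half per body, so that a body at rest
      contributes nothing and only row \<open>i\<close> survives.\<close>
    define f where "f k j = c k j * ((q $ k - q $ j) \<bullet> v $ k)" for k j
    have "f k j + f j k = c k j * ((q $ k - q $ j) \<bullet> (v $ k - v $ j))" for k j
      by (simp add: f_def c_sym[of j k] algebra_simps inner_simps)
    then have "(\<Sum>k\<in>UNIV. \<Sum>j\<in>UNIV. f k j + f j k) =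
        2 * (\<Sum>(k, j)\<in>body_pairs. c k j * ((q $ k - q $ j) \<bullet> (v $ k - v $ j)))"
      by (simp only:) (rule sum_body_pairs_symmetric, auto simp: c_sym inner_simps)
    moreover have "(\<Sum>k\<in>UNIV. \<Sum>j\<in>UNIV. f j k) = (\<Sum>k\<in>UNIV. \<Sum>j\<in>UNIV. f k j)"
      by (rule sum.swap)
    moreover have "(\<Sum>(k, j)\<in>body_pairs. c k j * ((q $ k - q $ j) \<bullet> (v $ k - v $ j))) = 0"
    proof -
      define w where "w k j = m $ k * m $ j * ((q $ k - q $ j) \<bullet> (v $ k - v $ j))" for k j
      have "(\<Sum>(k, j)\<in>body_pairs. c k j * ((q $ k - q $ j) \<bullet> (v $ k - v $ j))) =
          (\<Sum>(k, j)\<in>body_pairs. w k j / dist (q $ k) (q $ j) ^ 3) - \<kappa> * (\<Sum>(k, j)\<in>body_pairs. w k j)"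
        unfolding sum_distrib_left sum_subtractf[symmetric]
        by (rule sum.cong) (auto simp: c_def w_def algebra_simps diff_divide_distrib)
      moreover have "- (\<Sum>(k, j)\<in>body_pairs. w k j / dist (q $ k) (q $ j) ^ 3) +
          potential m q / (2 * I0) * ((1 / total_mass m) * (2 * (\<Sum>(k, j)\<in>body_pairs. w k j))) = 0"
        using critical_point_multiplier[OF I0 crit potential_line_has_real_derivative[OF inj]
            inertia_line_has_real_derivative[OF inj], of v]
        by (simp only: w_def)
      ultimately show ?thesis
        by (simp add: \<kappa>_def)
    qed
    ultimately have "(\<Sum>k\<in>UNIV. \<Sum>j\<in>UNIV. f k j) = 0"
      by (simp add: sum.distrib)
    also have "(\<Sum>k\<in>UNIV. \<Sum>j\<in>UNIV. f k j) = (\<Sum>k\<in>UNIV. if k = i then \<Sum>j\<in>UNIV. f i j else 0)"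
      by (rule sum.cong) (auto simp: f_def v_def axis_def)
    finally show ?thesis
      by (simp add: f_def c_def v_def axis_def sum_distrib_left mult.assoc)
  qed
  then show thesis
    using less_imp_neq[OF pos, symmetric] that[of \<kappa>] by simp
qed

section \<open>Plane geometry\<close>

lemma convex_configuration_not_between:
  assumes "convex_configuration q" "j \<noteq> i" "k \<noteq> i"
  shows "q $ i \<notin> closed_segment (q $ j) (q $ k)"
proof -
  have "closed_segment (q $ j) (q $ k) \<subseteq> convex hull {q $ j | j. j \<noteq> i}"
    unfolding segment_convex_hull using assms by (intro hull_mono) auto
  then show ?thesis
    using assms by (auto simp: convex_configuration_def)
qed

text \<open>Of three collinear points one lies between the other two, hence in the hull of the
  remaining bodies.\<close>

lemma convex_configuration_not_collinear:
  assumes "convex_configuration q" "distinct [i, j, k]"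
  shows "\<not> collinear {q $ i, q $ j, q $ k}"
  using assms convex_configuration_not_between[OF assms(1)]
  by (auto simp: collinear_between_cases between_mem_segment)

text \<open>Serves to rule out that the two diagonals share an endpoint: \<open>y\<close> is the
  reflection of \<open>a\<close> in a point of the line through \<open>a\<close> and
  \<open>b\<close>.\<close>

lemma collinear_midpoint_on_segment:
  fixes a b y :: "'a::euclidean_space"
  assumes "midpoint a y \<in> closed_segment a b"
  shows "collinear {a, b, y}"
proof -
  obtain u where "midpoint a y = (1 - u) *\<^sub>R a + u *\<^sub>R b"
    using assms by (auto simp: in_segment)
  moreover have "y = 2 *\<^sub>R midpoint a y - a"
    by (simp add: midpoint_def)
  ultimately have "y = 2 *\<^sub>R ((1 - u) *\<^sub>R a + u *\<^sub>R b) - a"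
    by simp
  then have "b - a = 1 *\<^sub>R (b - a) \<and> y - a = (2 * u) *\<^sub>R (b - a)"
    by (simp add: algebra_simps scaleR_2)
  then have "collinear {0, b - a, y - a}"
    unfolding collinear_lemma by blast
  then show ?thesis
    using collinear_3[of b a y] by (simp add: insert_commute)
qed

text \<open>The explicit vector is \<open>d\<close> turned by a right angle, so the determinant of
  \<open>d\<close> and \<open>s\<close> vanishes and the projection of \<open>s\<close> onto
  \<open>d\<close> is all of \<open>s\<close>.\<close>

lemma perpendicular_same_direction_real2:
  fixes d s :: "real^2"
  assumes "d \<noteq> 0" "vector [- d $ 2, d $ 1] \<bullet> s = 0"
  obtains c where "s = c *\<^sub>R d"
proof
  show "s = ((d \<bullet> s) / (d \<bullet> d)) *\<^sub>R d"
  proof -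
    have eq: "d $ 1 * s $ 2 = d $ 2 * s $ 1"
      using assms(2) by (simp add: inner_vec_def sum_2)
    have dd: "d \<bullet> d \<noteq> 0" using assms(1) by simp
    have "(d \<bullet> d) * s $ i = (d \<bullet> s) * d $ i" for i :: 2
      using exhaust_2[of i] eq by (auto simp: inner_vec_def sum_2 algebra_simps)
    then show ?thesis
      using dd by (simp add: vec_eq_iff field_simps)
  qed
qed

lemma kiteI:
  assumes "distinct [i, j, k, l]" "q $ i \<noteq> q $ j"
    and "midpoint (q $ k) (q $ l) \<in> closed_segment (q $ i) (q $ j)"
    and "(q $ j - q $ i) \<bullet> (q $ k - q $ l) = 0"
  shows "kite q"
proof -
  \<comment> \<open>The bisecting diagonal spans the axis of symmetry.\<close>
  define L where "L = affine hull {q $ i, q $ j}"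
  have "is_line L"
    using assms(2) by (simp add: is_line_def L_def aff_dim_affine_hull aff_dim_2)
  moreover have "q $ i \<in> L" "q $ j \<in> L"
    by (auto simp: L_def hull_inc)
  moreover have "midpoint (q $ k) (q $ l) \<in> L"
    using assms(3) convex_hull_subset_affine_hull unfolding L_def segment_convex_hull by blast
  moreover have "(u - v) \<bullet> (q $ k - q $ l) = 0" if uv: "u \<in> L" "v \<in> L" for u v
  proof -
    obtain s t where "u = q $ i + s *\<^sub>R (q $ j - q $ i)" "v = q $ i + t *\<^sub>R (q $ j - q $ i)"
      using uv by (auto simp: L_def affine_hull_2_alt)
    then have "u - v = (s - t) *\<^sub>R (q $ j - q $ i)"
      by (simp add: scaleR_left_diff_distrib)
    then show ?thesis
      using assms(4) by simp
  qed
  ultimately show ?thesis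
    unfolding kite_def mirror_images_def using assms(1) by blast
qed

text \<open>Squared distances are used for the comparison because they expand into inner
  products.\<close>

lemma less_inverse_cube_iff:
  fixes x y :: real
  assumes "x > 0" "y > 0"
  shows "1 / x ^ 3 < 1 / y ^ 3 \<longleftrightarrow> y\<^sup>2 < x\<^sup>2"
proof -
  have "1 / x ^ 3 < 1 / y ^ 3 \<longleftrightarrow> y ^ 3 < x ^ 3"
    using assms by (simp add: field_simps)
  then show ?thesis
    using assms by (simp add: power_mono_iff linorder_not_le[symmetric])
qed

text \<open>The relation between \<open>s\<close> and \<open>s'\<close> gives them the same sign,
  which need not be known. The two strict inequalities would make \<open>\<mu> - \<nu>\<close> and
  \<open>\<nu> - \<mu>\<close> both agree with that sign.\<close>

lemma opposite_weight_comparison: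
  fixes s t s' t' :: real
  assumes "\<mu> > 0" "\<alpha> > 0" "\<beta> > 0"
    and "\<mu> * s = \<nu> * t" "\<mu> * s' = \<nu> * t'" "\<alpha> * s = \<beta> * s'" "\<nu> > 0"
  shows "\<not> (s < t \<and> t' < s')"
proof
  assume *: "s < t \<and> t' < s'"
  have "(\<mu> - \<nu>) * s = \<nu> * (t - s)" "(\<nu> - \<mu>) * s' = \<nu> * (s' - t')"
    using assms by (auto simp: algebra_simps)
  then have "(\<mu> - \<nu>) * s > 0" "(\<nu> - \<mu>) * s' > 0"
    using * assms by auto
  then have "\<alpha> * ((\<mu> - \<nu>) * s) > 0" "\<beta> * ((\<nu> - \<mu>) * s') > 0"
    using assms by auto
  moreover have "\<alpha> * ((\<mu> - \<nu>) * s) = - (\<beta> * ((\<nu> - \<mu>) * s'))"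
    using assms(6) by algebra
  ultimately show False by linarith
qed

section \<open>Bisecting diagonals\<close>

lemma bisecting_diagonal_orthogonal:
  fixes q :: config
  assumes pos: "\<And>i. m $ i > 0" and inj: "inj (\<lambda>i. q $ i)"
    and eqs: "\<And>i e. (\<Sum>j\<in>UNIV. m $ j * (1 / dist (q $ i) (q $ j) ^ 3 - \<kappa>) * ((q $ i - q $ j) \<bullet> e)) = 0"
    and convex: "convex_configuration q" and ijkl: "distinct [i, j, k, l]"
    and mid: "midpoint (q $ k) (q $ l) \<in> closed_segment (q $ i) (q $ j)"
  shows "(q $ j - q $ i) \<bullet> (q $ k - q $ l) = 0"
proof -
  define d where "d = q $ j - q $ i"
  define s where "s = q $ k - q $ l"
  \<comment> \<open>Quarter turns of the diagonals: projecting on \<open>e\<close> removes the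
    interaction of \<open>i\<close> with \<open>j\<close>, projecting on \<open>f\<close> that of
    \<open>k\<close> with \<open>l\<close>.\<close>
  define e :: "real^2" where "e = vector [- d $ 2, d $ 1]"
  define f :: "real^2" where "f = vector [- s $ 2, s $ 1]"
  define P where "P = midpoint (q $ k) (q $ l)"
  define S where "S x y = 1 / dist (q $ x) (q $ y) ^ 3 - \<kappa>" for x y
  have S_sym: "S x y = S y x" for x y
    by (simp add: S_def dist_commute)
  obtain t where t: "0 \<le> t" "t \<le> 1" "P = (1 - t) *\<^sub>R q $ i + t *\<^sub>R q $ j"
    using mid by (auto simp: in_segment P_def)
  have qk: "q $ k = P + (1/2) *\<^sub>R s" and ql: "q $ l = P - (1/2) *\<^sub>R s"
    by (simp_all add: P_def s_def midpoint_def vec_eq_iff field_simps)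
  have qi: "q $ i = P - t *\<^sub>R d" and qj: "q $ j = P + (1 - t) *\<^sub>R d"
    by (simp_all add: t(3) d_def algebra_simps)
  have Pkl: "P \<in> closed_segment (q $ k) (q $ l)"
    by (simp add: P_def)
  \<comment> \<open>At \<open>t = 0\<close> or \<open>t = 1\<close> an endpoint of the bisecting
    diagonal would lie on the other one, against convexity.\<close>
  have "t \<noteq> 0"
    using Pkl qi convex_configuration_not_between[OF convex, of k i l] ijkl by auto
  moreover have "t \<noteq> 1"
    using Pkl qj convex_configuration_not_between[OF convex, of k j l] ijkl by auto
  ultimately have t01: "0 < t" "t < 1" using t by auto
  have ne: "q $ x \<noteq> q $ y" if "x \<noteq> y" for x y
    using inj that by (auto simp: inj_def)
  have "d \<noteq> 0" using ne[of i j] ijkl by (auto simp: d_def)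
  \<comment> \<open>Parallel diagonals would put \<open>k\<close> on the line through
    \<open>i\<close> and \<open>j\<close>, since \<open>P\<close> lies on it.\<close>
  have es: "e \<bullet> s \<noteq> 0"
  proof
    assume "e \<bullet> s = 0"
    then obtain c where c: "s = c *\<^sub>R d"
      using perpendicular_same_direction_real2[OF \<open>d \<noteq> 0\<close>] by (auto simp: e_def)
    have "q $ j - q $ i = 1 *\<^sub>R d \<and> q $ k - q $ i = (t + c / 2) *\<^sub>R d"
      unfolding qi qj qk c by (simp add: algebra_simps)
    then have "collinear {0, q $ j - q $ i, q $ k - q $ i}"
      unfolding collinear_lemma d_def by metis
    then have "collinear {q $ i, q $ j, q $ k}"
      using collinear_3[of "q $ j" "q $ i" "q $ k"] by (simp add: insert_commute)
    then show False
      using convex_configuration_not_collinear[OF convex, of i j k] ijkl by auto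
  qed
  \<comment> \<open>\<open>e \<bullet> s\<close> and \<open>d \<bullet> f\<close> are the same
    determinant up to sign, so one nonzero factor cancels from all three projected
    equations.\<close>
  have orth: "d \<bullet> e = 0" "s \<bullet> f = 0" "d \<bullet> f = - (e \<bullet> s)"
    by (auto simp: e_def f_def inner_vec_def sum_2)
  have "card {i, j, k, l} = CARD(4)" using ijkl by simp
  then have UNIV_eq: "UNIV = {i, j, k, l}"
    by (metis card_subset_eq finite subset_UNIV)
  have sums: "(\<Sum>x\<in>UNIV. h x) = h i + h j + h k + h l" for h :: "4 \<Rightarrow> real"
    unfolding UNIV_eq using ijkl by simp
  \<comment> \<open>Here bisection enters: \<open>k\<close> and \<open>l\<close> are equally far
    from the line through \<open>i\<close> and \<open>j\<close>, on opposite sides, so only masses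
    and weights remain.\<close>
  have "(e \<bullet> s) * (m $ l * S i l - m $ k * S i k) = 0"
    using eqs[of i e] unfolding sums S_def[symmetric]
    by (simp add: qi qj qk ql inner_simps orth inner_commute[of s e] algebra_simps)
  then have i: "m $ k * S i k = m $ l * S i l"
    using es unfolding mult_eq_0_iff right_minus_eq by metis
  have "(e \<bullet> s) * (m $ l * S j l - m $ k * S j k) = 0"
    using eqs[of j e] unfolding sums S_def[symmetric]
    by (simp add: qi qj qk ql inner_simps orth inner_commute[of s e] algebra_simps)
  then have j: "m $ k * S j k = m $ l * S j l"
    using es unfolding mult_eq_0_iff right_minus_eq by metis
  \<comment> \<open>Bodies \<open>i\<close> and \<open>j\<close> lie on opposite sides of the line
    through \<open>k\<close> and \<open>l\<close>, at distances in the ratio \<open>t\<close> to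
    \<open>1 - t\<close>; hence the positive coefficients in the relation below.\<close>
  have kf: "(q $ k - q $ i) \<bullet> f = - t * (e \<bullet> s)" "(q $ k - q $ j) \<bullet> f = (1 - t) * (e \<bullet> s)"
    using orth by (simp_all add: qi qj qk inner_simps algebra_simps)
  have "(e \<bullet> s) * (m $ i * t * S i k - m $ j * (1 - t) * S j k) = 0"
    using eqs[of k f] unfolding sums S_def[symmetric] s_def[symmetric] kf orth
    by (simp add: S_sym[of k i] S_sym[of k j] algebra_simps)
  then have k: "(m $ i * t) * S i k = (m $ j * (1 - t)) * S j k"
    using es unfolding mult_eq_0_iff right_minus_eq by blast
  have less_iff: "S x y < S x z \<longleftrightarrow> dist (q $ x) (q $ z) ^ 2 < dist (q $ x) (q $ y) ^ 2"
    if "x \<noteq> y" "x \<noteq> z" for x y z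
    unfolding S_def using less_inverse_cube_iff that ne by simp
  \<comment> \<open>From \<open>i\<close> the vectors to \<open>k\<close> and \<open>l\<close> are
    \<open>t *\<^sub>R d\<close> plus or minus half of \<open>s\<close>, so only the cross terms
    survive. From \<open>j\<close> the component along \<open>d\<close> is reversed, and with it the
    sign.\<close>
  have ri: "dist (q $ i) (q $ k) ^ 2 - dist (q $ i) (q $ l) ^ 2 = 2 * t * (d \<bullet> s)"
    by (simp add: dist_norm power2_norm_eq_inner qi qk ql inner_simps inner_commute algebra_simps)
  have rj: "dist (q $ j) (q $ k) ^ 2 - dist (q $ j) (q $ l) ^ 2 = - (2 * (1 - t) * (d \<bullet> s))"
    by (simp add: dist_norm power2_norm_eq_inner qj qk ql inner_simps inner_commute algebra_simps)
  have "d \<bullet> s = 0"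
  proof (rule ccontr)
    assume "d \<bullet> s \<noteq> 0"
    then consider "d \<bullet> s > 0" | "d \<bullet> s < 0" by linarith
    then show False
    proof cases
      case 1
      \<comment> \<open>Body \<open>k\<close> is farther than \<open>l\<close> from \<open>i\<close>
        but nearer to \<open>j\<close>, and a larger distance means a smaller weight.\<close>
      then have "2 * t * (d \<bullet> s) > 0" "2 * (1 - t) * (d \<bullet> s) > 0" using t01 by auto
      then have "S i k < S i l" "S j l < S j k"
        using less_iff[of i k l] less_iff[of j l k] ri rj ijkl by auto
      then show False
        using opposite_weight_comparison[OF _ _ _ i j k] pos t01 by simp
    next
      case 2
      \<comment> \<open>The same contradiction with \<open>i\<close> and \<open>j\<close>
        exchanged.\<close>
      then have "2 * t * (d \<bullet> s) < 0" "2 * (1 - t) * (d \<bullet> s) < 0"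
        using t01 by (auto simp: mult_pos_neg)
      then have "S i l < S i k" "S j k < S j l"
        using less_iff[of i l k] less_iff[of j k l] ri rj ijkl by auto
      then show False
        using opposite_weight_comparison[OF _ _ _ j i k[symmetric]] pos t01 by simp
    qed
  qed
  then show ?thesis by (simp add: d_def s_def)
qed

theorem theorem4p1:
  fixes m :: masses and q :: config
  assumes "\<And>i. m $ i > 0"
    and "central_configuration m q"
    and "convex_configuration q"
    and "some_diagonal_bisects_other q"
  shows "kite q"
proof -
  obtain i j k l where ij: "i \<noteq> j" and kl: "k \<noteq> l" and pairs: "{i, j} \<noteq> {k, l}"
    and mid: "midpoint (q $ k) (q $ l) \<in> closed_segment (q $ i) (q $ j)"
    using assms(4) unfolding some_diagonal_bisects_other_def is_diagonal_def by blast
  \<comment> \<open>Different index pairs could still overlap in one index; then three distinct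
    vertices would be collinear.\<close>
  have disjoint: "x \<noteq> a"
    if "a \<noteq> b" "x \<noteq> y" "{a, b} \<noteq> {x, y}"
      "midpoint (q $ x) (q $ y) \<in> closed_segment (q $ a) (q $ b)" for a b x y
  proof
    assume "x = a"
    then have "collinear {q $ a, q $ b, q $ y}" "distinct [a, b, y]"
      using that collinear_midpoint_on_segment by auto
    then show False
      using convex_configuration_not_collinear[OF assms(3)] by blast
  qed
  have "k \<noteq> i" "k \<noteq> j" "l \<noteq> i" "l \<noteq> j"
    using disjoint[of i j k l] disjoint[of j i k l] disjoint[of i j l k] disjoint[of j i l k] ij kl pairs mid
    by (auto simp: insert_commute midpoint_sym closed_segment_commute)
  then have ijkl: "distinct [i, j, k, l]"
    using ij kl by auto
  have inj: "inj (\<lambda>i. q $ i)"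
    using assms(2) by (simp add: central_configuration_def)
  obtain \<kappa> where
    "\<And>i e. (\<Sum>j\<in>UNIV. m $ j * (1 / dist (q $ i) (q $ j) ^ 3 - \<kappa>) * ((q $ i - q $ j) \<bullet> e)) = 0"
    using central_configuration_equations[OF assms(1,2)] by blast
  then have "(q $ j - q $ i) \<bullet> (q $ k - q $ l) = 0"
    using bisecting_diagonal_orthogonal[OF assms(1) inj _ assms(3) ijkl mid] by blast
  then show ?thesis
    using kiteI[OF ijkl _ mid] inj ij by (auto simp: inj_def)
qed

end
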